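(* Let a single-vertex crease pattern on the unit sphere $\mathbb{S}^2$ consist of $n$ great-circle fold curves (great-circle arcs) emanating from a common vertex, with consecutive face angles $\alpha_1,\alpha_2,\ldots,\alpha_n$ summing to $2\pi$. The pattern is flat-foldable (that is, foldable entirely within $\mathbb{S}^2$) if and only if $n$ is even and the alternating sum of the face angles vanishes: $$\alpha_1-\alpha_2+\alpha_3-\cdots-\alpha_n=0.$$
   Context: $\mathbb{S}^2\subset\mathbb{R}^3$ is the unit sphere. A great circle is represented by a unit vector $\mathbf{a}$ (its pole) and consists of the points $\mathbf{p}\in\mathbb{S}^2$ with $\mathbf{a}\cdot\mathbf{p}=0$. A (flat) fold on $\mathbb{S}^2$ across a great circle with pole $\mathbf{a}$ is the reflection $\mathbf{p}\mapsto\mathbf{p}-2(\mathbf{a}\cdot\mathbf{p})\mathbf{a}$. The $n$ arcs emanating from the vertex cut a neighbourhood of the vertex into $n$ faces (sectors); the face angles $\alpha_i>0$ are the angles at the vertex between consecutive arcs, in cyclic order. Flat-foldable is meant in the usual sense of single-vertex flat origami, transferred to $\mathbb{S}^2$: there is a folded state in which the sheet near the vertex is mapped continuously into $\mathbb{S}^2$, isometrically on each face, with the images of any two adjacent faces related by folding (reflecting) across the image of their common crease, all $n$ creases being folded, and with the layers stackable without self-crossing. *)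

theory Defs
  imports "HOL-Analysis.Analysis"
begin

section \<open>Great circles and flat folds on the unit sphere\<close>

definition sphere_dist :: "real^3 \<Rightarrow> real^3 \<Rightarrow> real" where
  "sphere_dist p q = arccos (p \<bullet> q)"

definition great_circle :: "real^3 \<Rightarrow> (real^3) set" where
  "great_circle a = {p \<in> sphere 0 1. a \<bullet> p = 0}"

definition flat_fold :: "real^3 \<Rightarrow> real^3 \<Rightarrow> real^3" where
  "flat_fold a p = p - (2 * (a \<bullet> p)) *\<^sub>R a"


section \<open>Single-vertex crease patterns\<close>

text \<open>For a unit vector \<open>v\<close> and a unit tangent vector \<open>u\<close> at \<open>v\<close>: the vector \<open>u\<close> turned about \<open>v\<close>
  by the angle \<open>\<phi>\<close>, counterclockwise as seen from outside the sphere.\<close>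

definition turn :: "real^3 \<Rightarrow> real^3 \<Rightarrow> real \<Rightarrow> real^3" where
  "turn v u \<phi> = cos \<phi> *\<^sub>R u + sin \<phi> *\<^sub>R cross3 v u"

text \<open>The point reached from \<open>v\<close> after travelling the distance \<open>t\<close> along the great circle
  with initial direction \<open>u\<close>.\<close>

definition travel :: "real^3 \<Rightarrow> real^3 \<Rightarrow> real \<Rightarrow> real^3" where
  "travel v u t = cos t *\<^sub>R v + sin t *\<^sub>R u"

text \<open>The arc number \<open>i < n\<close> starts at the vertex \<open>v\<close> in the direction \<open>d i\<close> and has length \<open>l i\<close>;
  \<open>\<alpha> i\<close> is the angle from the arc \<open>i\<close> to the next one in counterclockwise order. As the angles are
  positive and make up one full turn, the arcs are pairwise distinct and listed in cyclic order.\<close>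

definition crease_pattern ::
  "real^3 \<Rightarrow> nat \<Rightarrow> (nat \<Rightarrow> real^3) \<Rightarrow> (nat \<Rightarrow> real) \<Rightarrow> (nat \<Rightarrow> real) \<Rightarrow> bool" where
  "crease_pattern v n d l \<alpha> \<longleftrightarrow>
     norm v = 1 \<and>
     (\<forall>i<n. norm (d i) = 1 \<and> v \<bullet> d i = 0 \<and> 0 < l i \<and> 0 < \<alpha> i \<and>
            d (Suc i mod n) = turn v (d i) (\<alpha> i)) \<and>
     (\<Sum>i<n. \<alpha> i) = 2 * pi"

text \<open>The pieces into which the arcs cut the disc of radius \<open>r\<close> about \<open>v\<close>. The face \<open>i\<close> lies between
  the creases \<open>i\<close> and \<open>Suc i mod n\<close>.\<close>

definition disc :: "real^3 \<Rightarrow> real \<Rightarrow> (real^3) set" where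
  "disc v r = {p \<in> sphere 0 1. sphere_dist v p < r}"

definition crease :: "real^3 \<Rightarrow> (nat \<Rightarrow> real^3) \<Rightarrow> real \<Rightarrow> nat \<Rightarrow> (real^3) set" where
  "crease v d r i = {travel v (d i) t |t. 0 \<le> t \<and> t < r}"

definition face ::
  "real^3 \<Rightarrow> (nat \<Rightarrow> real^3) \<Rightarrow> (nat \<Rightarrow> real) \<Rightarrow> real \<Rightarrow> nat \<Rightarrow> (real^3) set" where
  "face v d \<alpha> r i =
     {travel v (turn v (d i) \<phi>) t |t \<phi>. 0 \<le> t \<and> t < r \<and> 0 \<le> \<phi> \<and> \<phi> \<le> \<alpha> i}"

definition open_face ::
  "real^3 \<Rightarrow> (nat \<Rightarrow> real^3) \<Rightarrow> (nat \<Rightarrow> real) \<Rightarrow> real \<Rightarrow> nat \<Rightarrow> (real^3) set" where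
  "open_face v d \<alpha> r i =
     {travel v (turn v (d i) \<phi>) t |t \<phi>. 0 < t \<and> t < r \<and> 0 < \<phi> \<and> \<phi> < \<alpha> i}"


section \<open>Flat folded states\<close>

text \<open>In the last clause, \<open>g\<close> is the rigid motion of the sphere that places the face \<open>i\<close>; without a
  fold it would also place the next face. The great circle with pole \<open>a\<close> is the one through the
  image of the common crease. Every crease is folded, since the reflection is required at each one.\<close>

definition folded_map ::
  "real^3 \<Rightarrow> nat \<Rightarrow> (nat \<Rightarrow> real^3) \<Rightarrow> (nat \<Rightarrow> real) \<Rightarrow> real \<Rightarrow> (real^3 \<Rightarrow> real^3) \<Rightarrow> bool" where
  "folded_map v n d \<alpha> r f \<longleftrightarrow>
     continuous_on (disc v r) f \<and>
     f ` disc v r \<subseteq> sphere 0 1 \<and>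
     (\<forall>i<n. \<forall>p\<in>face v d \<alpha> r i. \<forall>q\<in>face v d \<alpha> r i.
        sphere_dist (f p) (f q) = sphere_dist p q) \<and>
     (\<forall>i<n. \<exists>a g. norm a = 1 \<and> orthogonal_transformation g \<and>
        f ` crease v d r (Suc i mod n) \<subseteq> great_circle a \<and>
        (\<forall>p\<in>face v d \<alpha> r i. f p = g p) \<and>
        (\<forall>p\<in>face v d \<alpha> r (Suc i mod n). f p = flat_fold a (g p)))"

definition between :: "(nat \<Rightarrow> nat \<Rightarrow> bool) \<Rightarrow> nat \<Rightarrow> nat \<Rightarrow> nat \<Rightarrow> bool" where
  "between below i k j \<longleftrightarrow> below i k \<and> below k j \<or> below j k \<and> below k i"

text \<open>\<open>below i j\<close>: the layer of the face \<open>i\<close> lies below that of the face \<open>j\<close>. It is only relevant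
  for faces with overlapping images, and has to be transitive only where three layers lie over a
  common point. (A folded map forces all angles to be at most \<open>pi\<close>, so two images overlap in a
  connected set, over which the order of the two layers cannot change.)

  The last two clauses say that the paper does not cross itself. A layer that continues across the
  image of a crease does not separate the two layers joined at that crease. If two creases have
  the same image and the layers joined at them lie on the same side of it, then the two pairs of
  layers do not interleave. Creases are compared by equality of their images because all images
  contain the image of \<open>v\<close>.\<close>

definition layer_order ::
  "real^3 \<Rightarrow> nat \<Rightarrow> (nat \<Rightarrow> real^3) \<Rightarrow> (nat \<Rightarrow> real) \<Rightarrow> real \<Rightarrow> (real^3 \<Rightarrow> real^3) \<Rightarrow>
   (nat \<Rightarrow> nat \<Rightarrow> bool) \<Rightarrow> bool" where
  "layer_order v n d \<alpha> r f below \<longleftrightarrow>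
     (let F = (\<lambda>i. f ` open_face v d \<alpha> r i);
          C = (\<lambda>i. f ` crease v d r (Suc i mod n));
          s = (\<lambda>i. Suc i mod n)
      in (\<forall>i<n. \<forall>j<n. i \<noteq> j \<and> F i \<inter> F j \<noteq> {} \<longrightarrow> (below i j \<longleftrightarrow> \<not> below j i)) \<and>
         (\<forall>i<n. \<forall>j<n. \<forall>k<n. F i \<inter> F j \<inter> F k \<noteq> {} \<and> below i j \<and> below j k \<longrightarrow> below i k) \<and>
         (\<forall>i<n. \<forall>k<n. k \<noteq> i \<and> k \<noteq> s i \<and> C i \<inter> F k \<noteq> {} \<longrightarrow> \<not> between below i k (s i)) \<and>
         (\<forall>i<n. \<forall>j<n. i \<noteq> j \<and> C i = C j \<and> F i \<inter> F (s i) \<inter> F j \<inter> F (s j) \<noteq> {} \<longrightarrow>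
            (between below i j (s i) \<longleftrightarrow> between below i (s j) (s i))))"

definition flat_foldable ::
  "real^3 \<Rightarrow> nat \<Rightarrow> (nat \<Rightarrow> real^3) \<Rightarrow> (nat \<Rightarrow> real) \<Rightarrow> (nat \<Rightarrow> real) \<Rightarrow> bool" where
  "flat_foldable v n d l \<alpha> \<longleftrightarrow>
     (\<exists>r f below. 0 < r \<and> r \<le> pi \<and> (\<forall>i<n. r \<le> l i) \<and>
        folded_map v n d \<alpha> r f \<and> layer_order v n d \<alpha> r f below)"

end

theory Submission
  imports Defs
begin

text \<open>On each face a folded state is a linear isometry, and two consecutive ones differ by the
  reflection across the image of their common crease. Hence in the tangent plane at the image of
  \<open>v\<close> the creases turn alternately left and right by the angles \<open>\<alpha> i\<close>. After one revolution the
  orientation must be restored, so that \<open>n\<close> is even, and the alternating sum is a multiple of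
  \<open>2 * pi\<close>; it vanishes because its absolute value is smaller than \<open>2 * pi\<close>.

  Conversely, if the alternating sum vanishes, the zigzag map of directions closes up and defines
  the folded map. Its image directions span at most a half-turn, since the positive and the negative
  angles each sum to \<open>pi\<close>. Cutting at a crease whose image is extremal and stacking the faces as an
  accordion from there gives the layers: the only crease joining non-consecutive layers is the
  extremal one, and no face passes over its image.\<close>

section \<open>Polar coordinates about a point of the sphere\<close>

definition tangent :: "real^3 \<Rightarrow> real^3 \<Rightarrow> bool" where
  "tangent v u \<longleftrightarrow> norm v = 1 \<and> norm u = 1 \<and> v \<bullet> u = 0"

lemma tangent_inner:
  assumes "tangent v u"
  shows "v \<bullet> v = 1" "u \<bullet> u = 1" "v \<bullet> u = 0" "u \<bullet> v = 0"
    "cross3 v u \<bullet> cross3 v u = 1" "v \<bullet> cross3 v u = 0" "u \<bullet> cross3 v u = 0"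
    "cross3 v u \<bullet> v = 0" "cross3 v u \<bullet> u = 0"
proof -
  show *: "v \<bullet> v = 1" "u \<bullet> u = 1" "v \<bullet> u = 0" "u \<bullet> v = 0"
    using assms by (auto simp: tangent_def norm_eq_1 inner_commute)
  show "cross3 v u \<bullet> cross3 v u = 1"
    using norm_cross[of v u] * assms
    by (simp add: tangent_def power2_norm_eq_inner)
qed (simp_all add: dot_cross_self)

text \<open>The residue \<open>w\<close> is orthogonal to all three frame vectors. By Lagrange's
  identity its cross product with \<open>cross3 v u\<close> vanishes; as \<open>w\<close> is also
  orthogonal to that unit vector, it is zero.\<close>

lemma tangent_expansion:
  assumes "tangent v u"
  shows "p = (p \<bullet> v) *\<^sub>R v + (p \<bullet> u) *\<^sub>R u + (p \<bullet> cross3 v u) *\<^sub>R cross3 v u"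
proof -
  define w where "w = p - ((p \<bullet> v) *\<^sub>R v + (p \<bullet> u) *\<^sub>R u + (p \<bullet> cross3 v u) *\<^sub>R cross3 v u)"
  have w: "w \<bullet> v = 0" "w \<bullet> u = 0" "w \<bullet> cross3 v u = 0"
    using tangent_inner[OF assms] by (simp_all add: w_def inner_diff_left inner_add_left)
  have "cross3 w (cross3 v u) = 0"
    using w by (simp add: Lagrange)
  moreover have "norm (cross3 v u) = 1"
    using tangent_inner(5)[OF assms] by (simp add: norm_eq_1)
  ultimately have "w = 0"
    using norm_cross[of w "cross3 v u"] w by simp
  then show ?thesis by (simp add: w_def)
qed

lemma tangent_parseval:
  assumes "tangent v u"
  shows "p \<bullet> q = (p \<bullet> v) * (q \<bullet> v) + (p \<bullet> u) * (q \<bullet> u) + (p \<bullet> cross3 v u) * (q \<bullet> cross3 v u)"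
proof -
  have "p \<bullet> q = ((p \<bullet> v) *\<^sub>R v + (p \<bullet> u) *\<^sub>R u + (p \<bullet> cross3 v u) *\<^sub>R cross3 v u) \<bullet> q"
    using tangent_expansion[OF assms, of p] by simp
  also have "\<dots> = (p \<bullet> v) * (q \<bullet> v) + (p \<bullet> u) * (q \<bullet> u) + (p \<bullet> cross3 v u) * (q \<bullet> cross3 v u)"
    unfolding inner_add_left inner_scaleR_left by (simp add: inner_commute[of _ q])
  finally show ?thesis .
qed

lemma cross3_turn:
  assumes "tangent v u"
  shows "cross3 v (turn v u x) = cos x *\<^sub>R cross3 v u - sin x *\<^sub>R u"
  using tangent_inner[OF assms]
  by (simp add: turn_def cross_add_right cross_mult_right Lagrange)

lemma tangent_turn:
  assumes "tangent v u" shows "tangent v (turn v u x)"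
proof -
  have "turn v u x \<bullet> turn v u x = (cos x)\<^sup>2 + (sin x)\<^sup>2"
    using tangent_inner[OF assms]
    by (simp add: turn_def inner_add_left inner_add_right power2_eq_square)
  then have "norm (turn v u x) = 1"
    by (simp add: norm_eq_1)
  moreover have "v \<bullet> turn v u x = 0"
    using tangent_inner[OF assms] by (simp add: turn_def inner_add_right)
  ultimately show ?thesis using assms by (simp add: tangent_def)
qed

lemma turn_turn:
  assumes "tangent v u" shows "turn v (turn v u x) y = turn v u (x + y)"
proof -
  have "turn v (turn v u x) y = cos y *\<^sub>R turn v u x + sin y *\<^sub>R cross3 v (turn v u x)"
    by (simp add: turn_def)
  also have "\<dots> = turn v u (x + y)"
    unfolding cross3_turn[OF assms]
    by (simp add: turn_def cos_add sin_add algebra_simps)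
  finally show ?thesis .
qed

lemma turn_0 [simp]: "turn v u 0 = u"
  by (simp add: turn_def)

lemma travel_0 [simp]: "travel v u 0 = v"
  by (simp add: travel_def)

lemma inner_travel_turn:
  assumes "tangent v u"
  shows "travel v (turn v u x) t \<bullet> v = cos t"
    "travel v (turn v u x) t \<bullet> u = sin t * cos x"
    "travel v (turn v u x) t \<bullet> cross3 v u = sin t * sin x"
  using tangent_inner[OF assms] by (simp_all add: travel_def turn_def inner_add_left)

text \<open>For radii in \<open>[0, pi)\<close> the cosine is injective and the sine positive off
  the centre, so polar coordinates are unique apart from the centre and full turns. Equal cosines
  and sines express congruence of the angles modulo \<open>2 * pi\<close>.\<close>

lemma travel_turn_eq_iff:
  assumes "tangent v u" "0 \<le> t" "t < pi" "0 \<le> t'" "t' < pi"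
  shows "travel v (turn v u x) t = travel v (turn v u y) t' \<longleftrightarrow>
    t = t' \<and> (t = 0 \<or> cos x = cos y \<and> sin x = sin y)"
proof
  assume eq: "travel v (turn v u x) t = travel v (turn v u y) t'"
  have "cos t = cos t'"
    using inner_travel_turn(1)[OF assms(1)] eq by metis
  then have tt: "t = t'"
    using assms by (simp add: cos_inj_pi)
  have "sin t * cos x = sin t * cos y" "sin t * sin x = sin t * sin y"
    using inner_travel_turn(2,3)[OF assms(1)] eq tt by metis+
  moreover have "sin t > 0" if "t \<noteq> 0"
    using that assms by (simp add: sin_gt_zero)
  ultimately show "t = t' \<and> (t = 0 \<or> cos x = cos y \<and> sin x = sin y)"
    using tt by (metis less_irrefl mult_left_cancel)
qed (auto simp: turn_def)

lemma norm_travel_turn: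
  assumes "tangent v u" shows "norm (travel v (turn v u x) t) = 1"
proof -
  have "travel v (turn v u x) t \<bullet> travel v (turn v u x) t
      = (cos t)\<^sup>2 + (sin t)\<^sup>2 * ((cos x)\<^sup>2 + (sin x)\<^sup>2)"
    by (subst tangent_parseval[OF assms])
      (simp only: inner_travel_turn[OF assms] power2_eq_square distrib_left mult_ac add.assoc)
  then show ?thesis by (simp add: norm_eq_1)
qed

text \<open>The radius is the distance from \<open>v\<close>; the other two coordinates then lie on
  a circle of radius \<open>sin t\<close>, which yields the angle. The bound on \<open>r\<close>
  keeps the antipode of \<open>v\<close> out.\<close>

lemma disc_polar:
  assumes "tangent v u" "r \<le> pi" "p \<in> disc v r"
  obtains t x where "0 \<le> t" "t < r" "0 \<le> x" "x < 2 * pi" "p = travel v (turn v u x) t"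
proof -
  have p: "norm p = 1" and r: "arccos (v \<bullet> p) < r"
    using assms(3) by (auto simp: disc_def sphere_dist_def)
  define t where "t = arccos (v \<bullet> p)"
  have "\<bar>v \<bullet> p\<bar> \<le> 1"
    using Cauchy_Schwarz_ineq2[of v p] p assms(1) by (simp add: tangent_def)
  then have t: "0 \<le> t" "t < r" "t < pi" "cos t = v \<bullet> p"
    using r assms(2) by (auto simp: t_def arccos_lbound cos_arccos)
  have "1 = (p \<bullet> v)\<^sup>2 + (p \<bullet> u)\<^sup>2 + (p \<bullet> cross3 v u)\<^sup>2"
    using tangent_parseval[OF assms(1), of p p] p by (simp add: norm_eq_1 power2_eq_square)
  then have s: "(p \<bullet> u)\<^sup>2 + (p \<bullet> cross3 v u)\<^sup>2 = (sin t)\<^sup>2"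
    using t(4) by (simp add: sin_squared_eq inner_commute)
  show thesis
  proof (cases "t = 0")
    case True
    then have "p \<bullet> u = 0" "p \<bullet> cross3 v u = 0" "p \<bullet> v = 1"
      using s t(4) by (simp_all add: sum_power2_eq_zero_iff inner_commute)
    then have "p = travel v (turn v u 0) t"
      using tangent_expansion[OF assms(1), of p] True by simp
    then show thesis using t by (intro that[of t 0]) auto
  next
    case False
    then have sp: "sin t > 0" using t by (simp add: sin_gt_zero)
    then have "((p \<bullet> u) / sin t)\<^sup>2 + ((p \<bullet> cross3 v u) / sin t)\<^sup>2 = 1"
      using s by (simp add: power_divide flip: add_divide_distrib)
    then obtain x where x: "0 \<le> x" "x < 2 * pi" "(p \<bullet> u) / sin t = cos x"
      "(p \<bullet> cross3 v u) / sin t = sin x"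
      using sincos_total_2pi by blast
    then have "p \<bullet> u = sin t * cos x" "p \<bullet> cross3 v u = sin t * sin x"
      using sp by (simp_all add: field_simps)
    then have "p = travel v (turn v u x) t"
      using tangent_expansion[OF assms(1), of p] t(4)
      by (simp add: travel_def turn_def inner_commute scaleR_add_right add.assoc)
    then show thesis using t x by (intro that) auto
  qed
qed

section \<open>Necessity\<close>

lemma linear_flat_fold: "linear (flat_fold a)"
  by (rule linearI) (simp_all add: flat_fold_def inner_add_right algebra_simps)

lemma tangent_linear_eq:
  assumes "tangent v u" "linear f" "linear g"
    and "f v = g v" "f u = g u" "f (cross3 v u) = g (cross3 v u)"
  shows "f = g"
proof
  fix p
  have "f ((p \<bullet> v) *\<^sub>R v + (p \<bullet> u) *\<^sub>R u + (p \<bullet> cross3 v u) *\<^sub>R cross3 v u)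
      = g ((p \<bullet> v) *\<^sub>R v + (p \<bullet> u) *\<^sub>R u + (p \<bullet> cross3 v u) *\<^sub>R cross3 v u)"
    using assms by (simp add: linear_add linear_scale)
  then show "f p = g p"
    using tangent_expansion[OF assms(1), of p] by simp
qed

text \<open>A face, however narrow, spans the space: it contains \<open>v\<close>, points in the
  direction \<open>d i\<close>, and points in a direction independent of these two.\<close>

lemma linear_eq_on_face:
  assumes "tangent v (d i)" "0 < r" "r \<le> pi" "0 < \<alpha> i" "linear f" "linear g"
    and eq: "\<And>p. p \<in> face v d \<alpha> r i \<Longrightarrow> f p = g p"
  shows "f = g"
proof (rule tangent_linear_eq[OF assms(1,5,6)])
  define t where "t = r / 2"
  \<comment> \<open>The cap \<open>pi / 2\<close> keeps \<open>sin x\<close> positive even if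
    \<open>\<alpha> i\<close> exceeds \<open>pi\<close>.\<close>
  define x where "x = min (\<alpha> i) (pi / 2)"
  have t: "0 < t" "t < r" "sin t > 0"
    using assms by (auto simp: t_def intro!: sin_gt_zero)
  have x: "0 < x" "x \<le> \<alpha> i" "x < pi" "sin x > 0"
    using assms by (auto simp: x_def min_def intro!: sin_gt_zero)
  have face: "travel v (turn v (d i) y) s \<in> face v d \<alpha> r i"
    if "0 \<le> s" "s < r" "0 \<le> y" "y \<le> \<alpha> i" for s y
    unfolding face_def using that by blast
  have "travel v (turn v (d i) 0) 0 \<in> face v d \<alpha> r i"
    using assms by (intro face) auto
  then show fv: "f v = g v" using eq by simp
  have *: "f (turn v (d i) y) = g (turn v (d i) y)" if "0 \<le> y" "y \<le> \<alpha> i" for y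
  proof -
    have "travel v (turn v (d i) y) t \<in> face v d \<alpha> r i"
      using that t by (intro face) auto
    from eq[OF this] have "sin t *\<^sub>R f (turn v (d i) y) = sin t *\<^sub>R g (turn v (d i) y)"
      using assms fv by (simp add: travel_def linear_add linear_scale)
    then show ?thesis using t by simp
  qed
  show fd: "f (d i) = g (d i)" using *[of 0] assms by simp
  have "sin x *\<^sub>R f (cross3 v (d i)) = sin x *\<^sub>R g (cross3 v (d i))"
    using *[of x] x assms fd by (simp add: turn_def linear_add linear_scale)
  then show "f (cross3 v (d i)) = g (cross3 v (d i))" using x by simp
qed

lemma flat_fold_fixed: "a \<bullet> p = 0 \<Longrightarrow> flat_fold a p = p"
  by (simp add: flat_fold_def)

text \<open>The pole \<open>a\<close> is \<open>\<plusminus> g (v \<times> u)\<close>, the only directions orthogonal to \<open>g v\<close> and \<open>g u\<close>.\<close>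

lemma flat_fold_normal:
  assumes "tangent v u" "orthogonal_transformation g" "norm a = 1" "a \<bullet> g v = 0" "a \<bullet> g u = 0"
  shows "flat_fold a (g (cross3 v u)) = - g (cross3 v u)"
proof -
  have lin: "linear g" using assms(2) by (rule orthogonal_transformation_linear)
  have inner: "g x \<bullet> g y = x \<bullet> y" for x y
    using assms(2) by (simp add: orthogonal_transformation_def)
  obtain b where b: "a = g b"
    using orthogonal_transformation_surj[OF assms(2)] by (metis surjD)
  define c where "c = b \<bullet> cross3 v u"
  have "b = c *\<^sub>R cross3 v u"
    using tangent_expansion[OF assms(1), of b] assms(4,5) by (simp add: b inner c_def)
  then have a: "a = c *\<^sub>R g (cross3 v u)" using lin by (simp add: b linear_scale)
  have 1: "g (cross3 v u) \<bullet> g (cross3 v u) = 1"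
    using tangent_inner(5)[OF assms(1)] by (simp add: inner)
  have "c * c = 1"
    using assms(3) 1 by (simp add: a norm_eq_1 del: norm_scaleR)
  then have "(2 * (a \<bullet> g (cross3 v u))) *\<^sub>R a = 2 *\<^sub>R g (cross3 v u)"
    using 1 by (simp add: a mult.assoc)
  then show ?thesis by (simp add: flat_fold_def scaleR_2)
qed

lemma crease_pattern_tangent:
  assumes "crease_pattern v n d l \<alpha>" "i < n"
  shows "tangent v (d i)" "0 < \<alpha> i" "0 < l i" "d (Suc i mod n) = turn v (d i) (\<alpha> i)"
  using assms by (auto simp: crease_pattern_def tangent_def)

lemma crease_pattern_pos:
  assumes "crease_pattern v n d l \<alpha>" shows "0 < n"
  using assms by (cases n) (auto simp: crease_pattern_def)

lemma folded_map_alternating: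
  assumes cp: "crease_pattern v n d l \<alpha>" and fm: "folded_map v n d \<alpha> r f"
    and r: "0 < r" "r \<le> pi"
  shows "even n" "(\<Sum>i<n. (-1) ^ i * \<alpha> i) = 0"
proof -
  note T = crease_pattern_tangent[OF cp]
  have n: "0 < n" using crease_pattern_pos[OF cp] .
  have smod: "Suc i mod n < n" for i using n by simp
  obtain a g where ag: "\<And>i. i < n \<Longrightarrow> norm (a i) = 1 \<and> orthogonal_transformation (g i) \<and>
        f ` crease v d r (Suc i mod n) \<subseteq> great_circle (a i) \<and>
        (\<forall>p\<in>face v d \<alpha> r i. f p = g i p) \<and>
        (\<forall>p\<in>face v d \<alpha> r (Suc i mod n). f p = flat_fold (a i) (g i p))"
    using fm unfolding folded_map_def by metis
  have lin: "linear (g i)" if "i < n" for i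
    using ag[OF that] orthogonal_transformation_linear by blast
  \<comment> \<open>Both sides are linear and agree with \<open>f\<close> on the next face.\<close>
  have step: "g (Suc i mod n) = flat_fold (a i) \<circ> g i" if i: "i < n" for i
  proof (rule linear_eq_on_face[where d = d and r = r and \<alpha> = \<alpha>])
    show "linear (flat_fold (a i) \<circ> g i)"
      by (intro linear_compose lin i linear_flat_fold)
    show "g (Suc i mod n) p = (flat_fold (a i) \<circ> g i) p" if "p \<in> face v d \<alpha> r (Suc i mod n)" for p
      using ag[OF i] ag[OF smod] that by simp
  qed (use T[OF smod] r lin[OF smod] in auto)
  \<comment> \<open>The images of the crease direction and of its normal under the motion of face
    \<open>i\<close> form a frame that records both position and orientation.\<close>
  define e b where "e i = g i (d i)" and "b i = g i (cross3 v (d i))" for i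
  have rec: "e (Suc i mod n) = cos (\<alpha> i) *\<^sub>R e i + sin (\<alpha> i) *\<^sub>R b i \<and>
      b (Suc i mod n) = sin (\<alpha> i) *\<^sub>R e i - cos (\<alpha> i) *\<^sub>R b i" if i: "i < n" for i
  proof -
    let ?q = "d (Suc i mod n)"
    have gi: "g i (travel v ?q t) = f (travel v ?q t)" if "0 \<le> t" "t < r" for t
    proof -
      have "travel v ?q t \<in> face v d \<alpha> r i"
        unfolding face_def T(4)[OF i] using that T(2)[OF i] by (blast intro: less_imp_le)
      then show ?thesis using ag[OF i] by simp
    qed
    have cr: "a i \<bullet> g i (travel v ?q t) = 0" if "0 \<le> t" "t < r" for t
    proof -
      have "f (travel v ?q t) \<in> f ` crease v d r (Suc i mod n)"
        unfolding crease_def using that by blast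
      then show ?thesis
        using gi[OF that] ag[OF i] by (auto simp: great_circle_def)
    qed
    \<comment> \<open>The pole is orthogonal to the image of \<open>v\<close> and of a second point
      of the crease, hence to the image of the crease direction, so that
      \<open>flat_fold_normal\<close> applies.\<close>
    have av: "a i \<bullet> g i v = 0" using cr[of 0] r by simp
    have "a i \<bullet> g i (travel v ?q (r / 2)) = 0" using cr r by simp
    then have "sin (r / 2) * (a i \<bullet> g i ?q) = 0"
      using av lin[OF i] by (simp add: travel_def linear_add linear_scale inner_add_right)
    moreover have "sin (r / 2) > 0" using r by (intro sin_gt_zero) auto
    ultimately have aq: "a i \<bullet> g i ?q = 0" by simp
    have "flat_fold (a i) (g i (cross3 v ?q)) = - g i (cross3 v ?q)"
      using flat_fold_normal[OF T(1)[OF smod] _ _ av aq] ag[OF i] by blast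
    then have "b (Suc i mod n) = - g i (cross3 v ?q)"
      using step[OF i] by (simp add: b_def)
    also have "\<dots> = sin (\<alpha> i) *\<^sub>R e i - cos (\<alpha> i) *\<^sub>R b i"
      using lin[OF i] unfolding T(4)[OF i] cross3_turn[OF T(1)[OF i]]
      by (simp add: linear_diff linear_scale e_def b_def)
    finally have bb: "b (Suc i mod n) = sin (\<alpha> i) *\<^sub>R e i - cos (\<alpha> i) *\<^sub>R b i" .
    have "e (Suc i mod n) = g i ?q"
      using step[OF i] flat_fold_fixed[OF aq] by (simp add: e_def)
    also have "\<dots> = cos (\<alpha> i) *\<^sub>R e i + sin (\<alpha> i) *\<^sub>R b i"
      using lin[OF i] unfolding T(4)[OF i]
      by (simp add: turn_def linear_add linear_scale e_def b_def)
    finally show ?thesis using bb by simp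
  qed
  define H where "H k = (\<Sum>i<k. (-1) ^ i * \<alpha> i)" for k
  \<comment> \<open>Each reflection reverses the frame, so the turns count with alternating signs:
    frame \<open>k\<close> is frame 0 rotated by \<open>H k\<close>, with its second vector negated
    for odd \<open>k\<close>. The reduction modulo \<open>n\<close> makes \<open>k = n\<close>
    return to frame 0.\<close>
  have ind: "e (k mod n) = cos (H k) *\<^sub>R e 0 + sin (H k) *\<^sub>R b 0 \<and>
      b (k mod n) = (-1) ^ k *\<^sub>R (cos (H k) *\<^sub>R b 0 - sin (H k) *\<^sub>R e 0)" if "k \<le> n" for k
    using that
  proof (induction k)
    case 0
    then show ?case by (simp add: H_def)
  next
    case (Suc k)
    then have k: "k < n" "k mod n = k" by auto
    have HS: "H (Suc k) = H k + (-1) ^ k * \<alpha> k" by (simp add: H_def)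
    have IH: "e k = cos (H k) *\<^sub>R e 0 + sin (H k) *\<^sub>R b 0"
      "b k = (-1) ^ k *\<^sub>R (cos (H k) *\<^sub>R b 0 - sin (H k) *\<^sub>R e 0)"
      using Suc k by auto
    show ?case
      using rec[OF k(1)] unfolding IH HS
      by (cases "even k")
        (simp_all add: cos_add sin_add cos_diff sin_diff algebra_simps)
  qed
  have ot: "g 0 x \<bullet> g 0 y = x \<bullet> y" for x y
    using ag[OF n] by (simp add: orthogonal_transformation_def)
  note on = tangent_inner[OF T(1)[OF n]]
  have eb: "e 0 \<bullet> e 0 = 1" "b 0 \<bullet> b 0 = 1" "e 0 \<bullet> b 0 = 0" "b 0 \<bullet> e 0 = 0"
    using on by (simp_all add: e_def b_def ot)
  have "e 0 \<bullet> e 0 = cos (H n)"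
    using ind[of n] eb by (metis add.right_neutral inner_add_left inner_scaleR_left le_refl
        mod_self mult.right_neutral mult_zero_right)
  then have c: "cos (H n) = 1" using eb by simp
  then have s: "sin (H n) = 0"
    using sin_cos_squared_add[of "H n"] by simp
  have "b 0 = (-1) ^ n *\<^sub>R b 0" using ind[of n] c s by simp
  then show ev: "even n"
    using eb by (metis inner_scaleR_left minus_one_power_iff mult.right_neutral one_neq_neg_one)
  obtain m where m: "n = Suc (Suc m)"
    using ev n by (cases n; cases "n - 1") auto
  have sum: "(\<Sum>i<n. \<alpha> i) = 2 * pi" using cp by (simp add: crease_pattern_def)
  have bound: "\<bar>H n\<bar> < 2 * pi"
  proof -
    \<comment> \<open>This sum is \<open>2 * pi + H n\<close> and the next one
      \<open>2 * pi - H n\<close>. All terms are nonnegative; the first sum is positive by index 0,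
      the second by index 1, which is below \<open>n\<close> since \<open>n\<close> is even and
      positive.\<close>
    have "0 < (\<Sum>i<n. (1 + (-1) ^ i) * \<alpha> i)"
      by (rule sum_pos2[where i = 0]) (use T(2) n in \<open>auto simp: minus_one_power_iff less_imp_le\<close>)
    moreover have "0 < (\<Sum>i<n. (1 - (-1) ^ i) * \<alpha> i)"
      by (rule sum_pos2[where i = 1]) (use T(2) m in \<open>auto simp: minus_one_power_iff less_imp_le\<close>)
    ultimately show ?thesis
      using sum by (simp add: H_def ring_distribs sum.distrib sum_subtractf)
  qed
  obtain k :: int where k: "H n = of_int k * 2 * pi"
    using c cos_one_2pi_int[of "H n"] by (auto simp: mult_ac)
  have "k = 0"
  proof (rule ccontr)
    assume "k \<noteq> 0"
    then have "1 \<le> \<bar>real_of_int k\<bar>" by linarith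
    then have "2 * pi \<le> \<bar>real_of_int k\<bar> * (2 * pi)" by simp
    then show False using bound k by (simp add: abs_mult)
  qed
  then show "(\<Sum>i<n. (-1) ^ i * \<alpha> i) = 0" using k by (simp add: H_def)
qed

section \<open>Sufficiency\<close>

text \<open>The isometry fixing \<open>v\<close> and taking the direction \<open>u\<close> to \<open>e\<close>; the sign \<open>\<sigma>\<close> decides
  whether it preserves or reverses the orientation.\<close>

definition place :: "real^3 \<Rightarrow> real^3 \<Rightarrow> real^3 \<Rightarrow> real \<Rightarrow> real^3 \<Rightarrow> real^3" where
  "place v u e \<sigma> p = (p \<bullet> v) *\<^sub>R v + (p \<bullet> u) *\<^sub>R e + (\<sigma> * (p \<bullet> cross3 v u)) *\<^sub>R cross3 v e"

lemma linear_place: "linear (place v u e \<sigma>)"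
  by (rule linearI) (simp_all add: place_def inner_add_left algebra_simps)

lemma orthogonal_place:
  assumes "tangent v u" "tangent v e" "\<sigma> * \<sigma> = 1"
  shows "orthogonal_transformation (place v u e \<sigma>)"
  unfolding orthogonal_transformation_def
proof (intro conjI allI linear_place)
  fix p q
  have 1: "(\<sigma> * x) * (\<sigma> * y) = x * y" for x y
    using assms(3) by (metis mult.assoc mult.left_commute mult_1)
  have *: "place v u e \<sigma> p \<bullet> v = p \<bullet> v" "place v u e \<sigma> p \<bullet> e = p \<bullet> u"
     "place v u e \<sigma> p \<bullet> cross3 v e = \<sigma> * (p \<bullet> cross3 v u)" for p
    using tangent_inner[OF assms(2)] by (simp_all add: place_def inner_add_left)
  show "place v u e \<sigma> p \<bullet> place v u e \<sigma> q = p \<bullet> q"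
    unfolding tangent_parseval[OF assms(2), of "place v u e \<sigma> p"] * 1
    using tangent_parseval[OF assms(1), of p q] by simp
qed

lemma place_travel_turn:
  assumes "tangent v u" "\<sigma> = 1 \<or> \<sigma> = -1"
  shows "place v u e \<sigma> (travel v (turn v u x) t) = travel v (turn v e (\<sigma> * x)) t"
  unfolding place_def inner_travel_turn[OF assms(1)]
  using assms(2) tangent_inner[OF assms(1)]
  by (elim disjE; simp add: vec_eq_iff travel_def turn_def; simp add: algebra_simps)

text \<open>Only the coordinate along \<open>cross3 v e\<close>, which is
  \<open>sin t * sin x\<close>, changes sign.\<close>

lemma flat_fold_travel_turn:
  assumes "tangent v e"
  shows "flat_fold (cross3 v e) (travel v (turn v e x) t) = travel v (turn v e (- x)) t"
  unfolding flat_fold_def inner_commute[of "cross3 v e"] inner_travel_turn[OF assms]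
  by (simp add: vec_eq_iff travel_def turn_def algebra_simps)

section \<open>Angles of the creases and of their images\<close>

locale alternating_pattern =
  fixes v :: "real^3" and n :: nat and d :: "nat \<Rightarrow> real^3" and l \<alpha> :: "nat \<Rightarrow> real"
  assumes pattern: "crease_pattern v n d l \<alpha>"
    and even: "even n"
    and alternating: "(\<Sum>i<n. (-1) ^ i * \<alpha> i) = 0"
begin

text \<open>Directions of the crease \<open>k\<close> and of its image, both measured from \<open>d 0\<close>. As neither is
  reduced modulo \<open>2 * pi\<close>, the image angles can be compared along the real line.\<close>

definition arc_angle :: "nat \<Rightarrow> real" where "arc_angle k = (\<Sum>i<k. \<alpha> i)"

definition image_angle :: "nat \<Rightarrow> real" where "image_angle k = (\<Sum>i<k. (-1) ^ i * \<alpha> i)"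

lemmas arc = crease_pattern_tangent[OF pattern]

lemma pos: "0 < n"
  by (rule crease_pattern_pos[OF pattern])

lemma suc_mod_less: "Suc i mod n < n"
  using pos by simp

lemma tangent_0: "tangent v (d 0)"
  using arc(1) pos by blast

lemma arc_angle_0 [simp]: "arc_angle 0 = 0"
  and arc_angle_Suc: "arc_angle (Suc k) = arc_angle k + \<alpha> k"
  and arc_angle_n: "arc_angle n = 2 * pi"
  using pattern by (simp_all add: arc_angle_def crease_pattern_def)

lemma image_angle_0 [simp]: "image_angle 0 = 0"
  and image_angle_Suc: "image_angle (Suc k) = image_angle k + (-1) ^ k * \<alpha> k"
  and image_angle_n: "image_angle n = 0"
  using alternating by (simp_all add: image_angle_def)

text \<open>This lemma and the next handle the wrap-around: the vanishing alternating sum closes up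
  the image angles, and the evenness of \<open>n\<close> lets the signs alternate there too.\<close>

lemma image_angle_Suc_mod: "i < n \<Longrightarrow> image_angle (Suc i mod n) = image_angle (Suc i)"
  using image_angle_n by (cases "Suc i = n") auto

lemma sign_Suc_mod: "i < n \<Longrightarrow> (-1) ^ (Suc i mod n) = - ((-1) ^ i :: real)"
  using even by (cases "Suc i = n") (auto simp: minus_one_power_iff)

lemma sign_cases: "(-1) ^ i = (1::real) \<or> (-1) ^ i = (-1::real)"
  by (simp add: minus_one_power_iff)

lemma arc_angle_mono:
  assumes "j \<le> k" "k \<le> n" shows "arc_angle j \<le> arc_angle k"
  unfolding arc_angle_def by (rule sum_mono2) (use assms arc(2) in \<open>auto simp: less_imp_le\<close>)

lemma arc_angle_bounds:
  assumes "i < n" "0 \<le> x" "x \<le> \<alpha> i"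
  shows "0 \<le> arc_angle i + x" "arc_angle i + x \<le> 2 * pi"
  using arc_angle_mono[of 0 i] arc_angle_mono[of "Suc i" n] assms arc_angle_Suc[of i] arc_angle_n by auto

lemma direction: "k < n \<Longrightarrow> d k = turn v (d 0) (arc_angle k)"
proof (induction k)
  case (Suc k)
  then show ?case
    using arc(4)[of k] turn_turn[OF tangent_0] by (simp add: arc_angle_Suc)
qed simp

lemma turn_direction: "i < n \<Longrightarrow> turn v (d i) x = turn v (d 0) (arc_angle i + x)"
  by (subst direction) (simp_all add: turn_turn[OF tangent_0])

text \<open>The zigzag function with slope \<open>(-1) ^ i\<close> on the sector \<open>i\<close>, as a sum of ramps.\<close>

definition fold_angle :: "real \<Rightarrow> real" where
  "fold_angle x = (\<Sum>i<n. (-1) ^ i * max 0 (min (\<alpha> i) (x - arc_angle i)))"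

text \<open>In sector \<open>i\<close> the earlier ramps are saturated at \<open>\<alpha> j\<close>,
  ramp \<open>i\<close> has reached \<open>x\<close>, and the later ramps have not started.\<close>

lemma fold_angle:
  assumes i: "i < n" and x: "0 \<le> x" "x \<le> \<alpha> i"
  shows "fold_angle (arc_angle i + x) = image_angle i + (-1) ^ i * x"
proof -
  have "fold_angle (arc_angle i + x)
      = (\<Sum>j<Suc i. (-1) ^ j * max 0 (min (\<alpha> j) (arc_angle i + x - arc_angle j)))"
    unfolding fold_angle_def
  proof (rule sum.mono_neutral_right)
    show "\<forall>j\<in>{..<n} - {..<Suc i}. (-1) ^ j * max 0 (min (\<alpha> j) (arc_angle i + x - arc_angle j)) = 0"
    proof
      fix j assume "j \<in> {..<n} - {..<Suc i}"
      then have "arc_angle (Suc i) \<le> arc_angle j" by (intro arc_angle_mono) auto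
      then show "(-1) ^ j * max 0 (min (\<alpha> j) (arc_angle i + x - arc_angle j)) = 0"
        using x by (simp add: arc_angle_Suc)
    qed
  qed (use i in auto)
  also have "\<dots> = (\<Sum>j<i. (-1) ^ j * \<alpha> j) + (-1) ^ i * x"
  proof -
    have "max 0 (min (\<alpha> j) (arc_angle i + x - arc_angle j)) = \<alpha> j" if "j < i" for j
      using arc_angle_mono[of "Suc j" i] arc(2)[of j] that i x by (simp add: arc_angle_Suc)
    then show ?thesis using x by simp
  qed
  finally show ?thesis by (simp add: image_angle_def)
qed

text \<open>The angles 0 and \<open>2 * pi\<close> name the same direction, so a map of directions
  needs equal values there.\<close>

lemma fold_angle_ends: "fold_angle (2 * pi) = fold_angle 0"
proof -
  obtain m where m: "n = Suc m" using pos gr0_conv_Suc by blast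
  have "fold_angle (arc_angle m + \<alpha> m) = image_angle m + (-1) ^ m * \<alpha> m"
    using m arc(2)[of m] by (intro fold_angle) auto
  moreover have "fold_angle (arc_angle 0 + 0) = image_angle 0 + (-1) ^ 0 * 0"
    using pos arc(2)[of 0] by (intro fold_angle) auto
  ultimately show ?thesis
    using arc_angle_n image_angle_n m arc_angle_Suc[of m] image_angle_Suc[of m] by simp
qed

section \<open>The folded map\<close>

definition fold_map :: "real^3 \<Rightarrow> real^3" where
  "fold_map p = (SOME q. \<exists>t x. 0 \<le> t \<and> t < pi \<and> 0 \<le> x \<and> x \<le> 2 * pi \<and>
     p = travel v (turn v (d 0) x) t \<and> q = travel v (turn v (d 0) (fold_angle x)) t)"

text \<open>The angle of a point is ambiguous at \<open>v\<close>, and on crease 0, where 0 and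
  \<open>2 * pi\<close> both occur. Neither affects the image, so the choice in
  \<open>fold_map\<close> is immaterial. Admitting \<open>2 * pi\<close> lets one formula cover the
  last face up to its final crease.\<close>

lemma fold_map_polar:
  assumes t: "0 \<le> t" "t < pi" and x: "0 \<le> x" "x \<le> 2 * pi"
  shows "fold_map (travel v (turn v (d 0) x) t) = travel v (turn v (d 0) (fold_angle x)) t"
  unfolding fold_map_def
proof (rule some_equality)
  show "\<exists>t' y. 0 \<le> t' \<and> t' < pi \<and> 0 \<le> y \<and> y \<le> 2 * pi \<and>
      travel v (turn v (d 0) x) t = travel v (turn v (d 0) y) t' \<and>
      travel v (turn v (d 0) (fold_angle x)) t = travel v (turn v (d 0) (fold_angle y)) t'"
    using assms by blast
next
  fix q
  assume "\<exists>t' y. 0 \<le> t' \<and> t' < pi \<and> 0 \<le> y \<and> y \<le> 2 * pi \<and>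
      travel v (turn v (d 0) x) t = travel v (turn v (d 0) y) t' \<and>
      q = travel v (turn v (d 0) (fold_angle y)) t'"
  then obtain t' y where t': "0 \<le> t'" "t' < pi" and y: "0 \<le> y" "y \<le> 2 * pi"
    and eq: "travel v (turn v (d 0) x) t = travel v (turn v (d 0) y) t'"
    and q: "q = travel v (turn v (d 0) (fold_angle y)) t'" by blast
  have tt: "t = t'" and cs: "t = 0 \<or> cos x = cos y \<and> sin x = sin y"
    using eq travel_turn_eq_iff[OF tangent_0 t t'] by auto
  show "q = travel v (turn v (d 0) (fold_angle x)) t"
  proof (cases "t = 0")
    case True
    then show ?thesis using q tt by simp
  next
    case False
    then obtain k :: int where k: "x = y + 2 * pi * of_int k"
      using cs sin_cos_eq_iff[of x y] by auto
    \<comment> \<open>Both angles lie in \<open>[0, 2 * pi]\<close>, so they are equal or the two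
      ends of this interval.\<close>
    have "2 * pi * real_of_int k \<le> 2 * pi * 1" "2 * pi * (-1) \<le> 2 * pi * real_of_int k"
      using k x y by linarith+
    then have "real_of_int k \<le> 1" "-1 \<le> real_of_int k"
      by (simp_all only: mult_le_cancel_left_pos pi_gt_zero zero_less_mult_iff zero_less_numeral simp_thms)
    then have "k = 0 \<or> k = 1 \<or> k = -1" by linarith
    then have "x = y \<or> {x, y} = {0, 2 * pi}" using k x y by auto
    then have "fold_angle x = fold_angle y"
      using fold_angle_ends by (auto simp: doubleton_eq_iff)
    then show ?thesis using q tt by simp
  qed
qed

lemma fold_map_on_face:
  assumes "i < n" "0 \<le> t" "t < pi" "0 \<le> x" "x \<le> \<alpha> i"
  shows "fold_map (travel v (turn v (d i) x) t)
    = travel v (turn v (d 0) (image_angle i + (-1) ^ i * x)) t"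
  using assms fold_map_polar[OF assms(2,3) arc_angle_bounds]
  by (simp add: turn_direction[OF assms(1)] fold_angle)

definition motion :: "nat \<Rightarrow> real^3 \<Rightarrow> real^3" where
  "motion i = place v (d i) (turn v (d 0) (image_angle i)) ((-1) ^ i)"

lemma motion_polar:
  assumes "i < n"
  shows "motion i (travel v (turn v (d i) x) t)
    = travel v (turn v (d 0) (image_angle i + (-1) ^ i * x)) t"
  unfolding motion_def place_travel_turn[OF arc(1)[OF assms] sign_cases]
  by (simp add: turn_turn[OF tangent_0])

lemma fold_map_eq_motion:
  assumes "i < n" "r \<le> pi" "p \<in> face v d \<alpha> r i"
  shows "fold_map p = motion i p"
  using assms by (auto simp: face_def motion_polar fold_map_on_face)

lemma orthogonal_motion: "i < n \<Longrightarrow> orthogonal_transformation (motion i)"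
  unfolding motion_def
  using sign_cases[of i] by (intro orthogonal_place tangent_turn tangent_0 arc(1)) auto

lemma sector_cover:
  assumes "0 \<le> x" "x \<le> 2 * pi"
  obtains i y where "i < n" "0 \<le> y" "y \<le> \<alpha> i" "x = arc_angle i + y"
proof -
  define m where "m = (LEAST k. x \<le> arc_angle (Suc k))"
  have *: "x \<le> arc_angle (Suc (n - 1))" using assms arc_angle_n pos by simp
  have le: "x \<le> arc_angle (Suc m)" unfolding m_def using * by (rule LeastI)
  have "m \<le> n - 1" unfolding m_def using * by (rule Least_le)
  then have "m < n" using pos by simp
  moreover have "arc_angle m \<le> x"
  proof (cases m)
    case (Suc k)
    then have "\<not> x \<le> arc_angle (Suc k)"
      using not_less_Least[of k "\<lambda>k. x \<le> arc_angle (Suc k)"] by (simp add: m_def)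
    then show ?thesis using Suc by simp
  qed (use assms in simp)
  ultimately show thesis
    using le by (intro that[of m "x - arc_angle m"]) (auto simp: arc_angle_Suc)
qed

text \<open>Pasting: on each sector the map is the linear \<open>motion i\<close>, and finitely many
  closed sectors cover the disc. Radii are taken from \<open>[0, 1]\<close> to make the sectors
  compact while staying below \<open>pi\<close>.\<close>

lemma fold_map_continuous:
  assumes "r \<le> 1"
  shows "continuous_on (disc v r) fold_map"
proof -
  define K where "K i = (\<lambda>(t, x). travel v (turn v (d i) x) t) ` ({0..1} \<times> {0..\<alpha> i})" for i
  have pi: "1 < pi" using pi_gt3 by simp
  have "continuous_on (\<Union>i\<in>{..<n}. K i) fold_map"
  proof (rule continuous_on_closed_Union)
    fix i assume i: "i \<in> {..<n}"
    have "compact (K i)"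
      unfolding K_def travel_def turn_def case_prod_beta
      by (intro compact_continuous_image compact_Times compact_Icc continuous_intros)
    then show "closed (K i)" by (rule compact_imp_closed)
    have "continuous_on (K i) (motion i)"
      unfolding motion_def by (intro linear_continuous_on linear_linear[THEN iffD2] linear_place)
    moreover have "motion i p = fold_map p" if "p \<in> K i" for p
      using that i pi by (auto simp: K_def motion_polar fold_map_on_face)
    ultimately show "continuous_on (K i) fold_map"
      by (rule continuous_on_eq)
  qed simp
  moreover have "disc v r \<subseteq> (\<Union>i\<in>{..<n}. K i)"
  proof
    fix p assume "p \<in> disc v r"
    then obtain t x where t: "0 \<le> t" "t < r" and x: "0 \<le> x" "x < 2 * pi"
      and p: "p = travel v (turn v (d 0) x) t"
      using disc_polar[OF tangent_0, of r p] assms pi by auto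
    obtain i y where i: "i < n" and y: "0 \<le> y" "y \<le> \<alpha> i" "x = arc_angle i + y"
      using sector_cover[of x] x by auto
    then have "p = (\<lambda>(t, x). travel v (turn v (d i) x) t) (t, y)"
      using p by (simp add: turn_direction[OF i])
    then have "p \<in> K i"
      unfolding K_def using t y assms by (intro image_eqI[where x = "(t, y)"]) auto
    then show "p \<in> (\<Union>i\<in>{..<n}. K i)"
      using i by blast
  qed
  ultimately show ?thesis by (rule continuous_on_subset)
qed

lemma crease_image:
  assumes "i < n" "r \<le> pi"
  shows "fold_map ` crease v d r (Suc i mod n)
    = (\<lambda>t. travel v (turn v (d 0) (image_angle (Suc i mod n))) t) ` {0..<r}"
proof -
  have "crease v d r (Suc i mod n) = (\<lambda>t. travel v (turn v (d (Suc i mod n)) 0) t) ` {0..<r}"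
    by (auto simp: crease_def)
  then show ?thesis
    using fold_map_on_face[OF suc_mod_less, of _ 0 i] assms arc(2)[OF suc_mod_less, of i]
    by (simp add: image_image less_imp_le)
qed

lemma folded_map_fold_map:
  assumes "0 < r" "r \<le> 1"
  shows "folded_map v n d \<alpha> r fold_map"
  unfolding folded_map_def
proof (intro conjI allI impI ballI)
  have pi: "r \<le> pi" using assms pi_gt3 by simp
  show "continuous_on (disc v r) fold_map"
    using assms(2) by (rule fold_map_continuous)
  show "fold_map ` disc v r \<subseteq> sphere 0 1"
  proof
    fix q assume "q \<in> fold_map ` disc v r"
    then obtain p where p: "p \<in> disc v r" and q: "q = fold_map p" by blast
    obtain t x where "0 \<le> t" "t < r" "0 \<le> x" "x < 2 * pi" "p = travel v (turn v (d 0) x) t"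
      using disc_polar[OF tangent_0 pi p] .
    then show "q \<in> sphere 0 1"
      using q pi by (simp add: fold_map_polar norm_travel_turn[OF tangent_0])
  qed
  fix i assume i: "i < n"
  show "sphere_dist (fold_map p) (fold_map q) = sphere_dist p q"
    if "p \<in> face v d \<alpha> r i" "q \<in> face v d \<alpha> r i" for p q
    using that orthogonal_motion[OF i]
    by (simp add: fold_map_eq_motion[OF i pi] sphere_dist_def orthogonal_transformation_def)
  let ?s = "Suc i mod n"
  \<comment> \<open>The direction of the image of the common crease; \<open>cross3 v e\<close> is
    the pole of the great circle through it.\<close>
  define e where "e = turn v (d 0) (image_angle ?s)"
  have e: "tangent v e" by (simp add: e_def tangent_turn tangent_0)
  have turn_e: "turn v e x = turn v (d 0) (image_angle ?s + x)" for x
    by (simp add: e_def turn_turn[OF tangent_0])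
  show "\<exists>a g. norm a = 1 \<and> orthogonal_transformation g \<and>
      fold_map ` crease v d r ?s \<subseteq> great_circle a \<and>
      (\<forall>p\<in>face v d \<alpha> r i. fold_map p = g p) \<and>
      (\<forall>p\<in>face v d \<alpha> r ?s. fold_map p = flat_fold a (g p))"
  proof (intro exI[of _ "cross3 v e"] exI[of _ "motion i"] conjI ballI)
    show "norm (cross3 v e) = 1" using tangent_inner(5)[OF e] by (simp add: norm_eq_1)
    show "orthogonal_transformation (motion i)" using orthogonal_motion[OF i] .
    show "fold_map ` crease v d r ?s \<subseteq> great_circle (cross3 v e)"
    proof -
      have "travel v (turn v e 0) t \<in> great_circle (cross3 v e)" for t
        using inner_travel_turn(3)[OF e, of 0 t] norm_travel_turn[OF e, of 0 t]
        by (simp add: great_circle_def inner_commute)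
      then show ?thesis
        by (auto simp: crease_image[OF i pi] e_def)
    qed
    show "fold_map p = motion i p" if "p \<in> face v d \<alpha> r i" for p
      using fold_map_eq_motion[OF i pi that] .
    show "fold_map p = flat_fold (cross3 v e) (motion i p)" if p: "p \<in> face v d \<alpha> r ?s" for p
    proof -
      obtain t x where tx: "0 \<le> t" "t < r" "0 \<le> x" "x \<le> \<alpha> ?s" "p = travel v (turn v (d ?s) x) t"
        using p by (auto simp: face_def)
      \<comment> \<open>Measured from crease \<open>i\<close>, the next face starts at the angle
        \<open>\<alpha> i\<close>. Unfolded, it would continue past \<open>e\<close> by
        \<open>(-1) ^ i * x\<close>; the reflection negates this, matching the opposite slope of the
        next sector.\<close>
      have "motion i p = motion i (travel v (turn v (d i) (\<alpha> i + x)) t)"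
        by (simp add: tx arc(4)[OF i] turn_turn[OF arc(1)[OF i]])
      also have "\<dots> = travel v (turn v e ((-1) ^ i * x)) t"
        unfolding motion_polar[OF i] turn_e image_angle_Suc_mod[OF i] image_angle_Suc
          by (simp add: algebra_simps)
      finally have "flat_fold (cross3 v e) (motion i p) = travel v (turn v e (- ((-1) ^ i * x))) t"
        by (simp add: flat_fold_travel_turn[OF e])
      moreover have "fold_map p = travel v (turn v e (- ((-1) ^ i * x))) t"
        using fold_map_on_face[OF suc_mod_less, of t x i] tx pi
        by (simp add: turn_e sign_Suc_mod[OF i])
      ultimately show ?thesis by simp
    qed
  qed
qed

section \<open>Spread and coincidence of the image creases\<close>

lemma image_angle_variation:
  assumes "j \<le> k" "k \<le> n" shows "\<bar>image_angle k - image_angle j\<bar> \<le> pi"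
proof -
  have nonneg: "0 \<le> \<alpha> i" if "i < n" for i using arc(2)[OF that] by simp
  \<comment> \<open>For \<open>s = 1\<close> and \<open>s = -1\<close> the weight is the indicator
    of the indices with sign \<open>s\<close>. So the positive and the negative angles each sum to
    \<open>pi\<close>, which bounds the alternating sum over any block of indices.\<close>
  have half: "(\<Sum>i<n. (1 + s * (-1) ^ i) / 2 * \<alpha> i) = pi" for s
  proof -
    have "(\<Sum>i<n. (1 + s * (-1) ^ i) / 2 * \<alpha> i)
        = ((\<Sum>i<n. \<alpha> i) + s * (\<Sum>i<n. (-1) ^ i * \<alpha> i)) / 2"
      unfolding sum_distrib_left sum.distrib[symmetric] sum_divide_distrib
      by (intro sum.cong) (simp_all add: field_simps)
    then show ?thesis using pattern alternating by (simp add: crease_pattern_def)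
  qed
  have diff: "image_angle k - image_angle j = (\<Sum>i\<in>{j..<k}. (-1) ^ i * \<alpha> i)"
    using sum_diff_nat_ivl[of 0 j k "\<lambda>i. (-1) ^ i * \<alpha> i"] assms
    by (simp add: image_angle_def lessThan_atLeast0)
  have le: "s * (image_angle k - image_angle j) \<le> pi" if s: "s = 1 \<or> s = -1" for s
  proof -
    have "s * (image_angle k - image_angle j) = (\<Sum>i\<in>{j..<k}. s * ((-1) ^ i * \<alpha> i))"
      by (simp add: diff sum_distrib_left)
    also have "\<dots> \<le> (\<Sum>i\<in>{j..<k}. (1 + s * (-1) ^ i) / 2 * \<alpha> i)"
      using nonneg assms s by (intro sum_mono) (auto simp: minus_one_power_iff)
    also have "\<dots> \<le> (\<Sum>i<n. (1 + s * (-1) ^ i) / 2 * \<alpha> i)"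
      using nonneg assms s by (intro sum_mono2) (auto simp: minus_one_power_iff)
    finally show ?thesis using half by simp
  qed
  from le[of 1] le[of "-1"] show ?thesis by (auto simp: abs_if)
qed

lemma image_angle_diff: "j \<le> n \<Longrightarrow> k \<le> n \<Longrightarrow> \<bar>image_angle j - image_angle k\<bar> \<le> pi"
  using image_angle_variation[of j k] image_angle_variation[of k j]
  by (cases "j \<le> k") (auto simp: abs_minus_commute)

lemma lowest_crease:
  obtains c where "c < n" "\<And>k. k \<le> n \<Longrightarrow> image_angle c \<le> image_angle k"
proof -
  have "Min (image_angle ` {..<n}) \<in> image_angle ` {..<n}" using pos by (intro Min_in) auto
  then obtain c where c: "c < n" "image_angle c = Min (image_angle ` {..<n})" by auto
  have "image_angle c \<le> image_angle k" if "k < n" for k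
    unfolding c(2) using that by (intro Min_le) auto
  then have "image_angle c \<le> image_angle k" if "k \<le> n" for k
    using that image_angle_n pos by (cases "k = n") (force simp flip: image_angle_0)+
  then show thesis using c that by blast
qed

text \<open>The images determine the angles modulo \<open>2 * pi\<close>, and a spread of at most
  \<open>pi\<close> leaves no room for a nonzero multiple.\<close>

lemma crease_image_eq:
  assumes "i < n" "j < n" "0 < r" "r \<le> pi"
    and eq: "fold_map ` crease v d r (Suc i mod n) = fold_map ` crease v d r (Suc j mod n)"
  shows "image_angle (Suc i mod n) = image_angle (Suc j mod n)"
proof -
  have "travel v (turn v (d 0) (image_angle (Suc i mod n))) (r / 2)
      \<in> (\<lambda>t. travel v (turn v (d 0) (image_angle (Suc j mod n))) t) ` {0..<r}"
    using eq assms(3) unfolding crease_image[OF assms(1,4)] crease_image[OF assms(2,4)]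
    by (metis (mono_tags) atLeastLessThan_iff field_sum_of_halves image_eqI less_add_same_cancel1
        half_gt_zero less_imp_le)
  then obtain t where t: "0 \<le> t" "t < r"
    and "travel v (turn v (d 0) (image_angle (Suc i mod n))) (r / 2)
      = travel v (turn v (d 0) (image_angle (Suc j mod n))) t" by auto
  then have "cos (image_angle (Suc i mod n)) = cos (image_angle (Suc j mod n)) \<and>
      sin (image_angle (Suc i mod n)) = sin (image_angle (Suc j mod n))"
    using travel_turn_eq_iff[OF tangent_0, of "r / 2" t] assms by auto
  then obtain k :: int where k:
    "image_angle (Suc i mod n) = image_angle (Suc j mod n) + 2 * pi * of_int k"
    using sin_cos_eq_iff by blast
  have "\<bar>image_angle (Suc i mod n) - image_angle (Suc j mod n)\<bar> \<le> pi"
    by (intro image_angle_diff less_imp_le suc_mod_less)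
  then have "\<bar>2 * pi * of_int k\<bar> < 2 * pi * 1"
    using k pi_gt_zero by linarith
  then have "k = 0" by (simp add: abs_mult)
  then show ?thesis using k by simp
qed

text \<open>Consecutive image angles differ by a nonzero face angle up to sign. This rules out the
  neighbours of the lowest crease when coincident creases are compared.\<close>

lemma adjacent_crease_images:
  assumes "i < n" "0 < r" "r \<le> pi"
  shows "fold_map ` crease v d r (Suc i mod n) \<noteq> fold_map ` crease v d r (Suc (Suc i mod n) mod n)"
proof
  let ?s = "Suc i mod n"
  assume "fold_map ` crease v d r ?s = fold_map ` crease v d r (Suc ?s mod n)"
  then have "image_angle ?s = image_angle (Suc ?s mod n)"
    using crease_image_eq[OF assms(1) suc_mod_less assms(2,3)] by blast
  also have "\<dots> = image_angle ?s + (-1) ^ ?s * \<alpha> ?s"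
    using image_angle_Suc_mod[OF suc_mod_less, of i] by (simp add: image_angle_Suc)
  finally show False using arc(2)[OF suc_mod_less, of i] by simp
qed

text \<open>The interior of a face goes strictly between its two image creases, and these lie in the
  half-turn starting at the lowest one.\<close>

lemma open_face_image:
  assumes low: "\<And>k. k \<le> n \<Longrightarrow> image_angle c \<le> image_angle k" and "c < n" "k < n" "r \<le> pi"
    and q: "q \<in> fold_map ` open_face v d \<alpha> r k"
  obtains t x where "0 < t" "t < r" "image_angle c < x" "x < image_angle c + pi"
    "q = travel v (turn v (d 0) x) t"
proof -
  obtain t y where t: "0 < t" "t < r" and y: "0 < y" "y < \<alpha> k"
    and qq: "q = fold_map (travel v (turn v (d k) y) t)"
    using q by (auto simp: open_face_def)
  have "image_angle k + (-1) ^ k * y < max (image_angle k) (image_angle (Suc k))"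
    "min (image_angle k) (image_angle (Suc k)) < image_angle k + (-1) ^ k * y"
    using y sign_cases[of k] by (auto simp: image_angle_Suc)
  moreover have "image_angle c \<le> image_angle k" "image_angle c \<le> image_angle (Suc k)" using assms by auto
  moreover have "image_angle k \<le> image_angle c + pi" "image_angle (Suc k) \<le> image_angle c + pi"
    using image_angle_diff[of k c] image_angle_diff[of "Suc k" c] assms by auto
  ultimately have "image_angle c < image_angle k + (-1) ^ k * y"
    "image_angle k + (-1) ^ k * y < image_angle c + pi"
    by linarith+
  moreover have "q = travel v (turn v (d 0) (image_angle k + (-1) ^ k * y)) t"
    using qq t y assms by (simp add: fold_map_on_face)
  ultimately show thesis using t that by blast
qed

text \<open>No angle strictly inside that half-turn is congruent to its lower end, and the image of
  an open face avoids \<open>v\<close>.\<close>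

lemma lowest_crease_uncovered:
  assumes low: "\<And>k. k \<le> n \<Longrightarrow> image_angle c \<le> image_angle k"
    and "i < n" "Suc i mod n = c" "k < n" "r \<le> pi"
  shows "fold_map ` crease v d r (Suc i mod n) \<inter> fold_map ` open_face v d \<alpha> r k = {}"
proof (rule ccontr)
  have c: "c < n" using assms suc_mod_less by blast
  assume "\<not> ?thesis"
  then obtain q where q: "q \<in> fold_map ` crease v d r (Suc i mod n)"
    "q \<in> fold_map ` open_face v d \<alpha> r k" by blast
  obtain t' where t': "0 \<le> t'" "t' < r" "q = travel v (turn v (d 0) (image_angle c)) t'"
    using q(1) crease_image[OF assms(2,5)] assms(3) by auto
  obtain t x where t: "0 < t" "t < r" and x: "image_angle c < x" "x < image_angle c + pi"
    and "q = travel v (turn v (d 0) x) t"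
    using open_face_image[OF low c assms(4,5) q(2)] .
  then have "cos x = cos (image_angle c) \<and> sin x = sin (image_angle c)"
    using travel_turn_eq_iff[OF tangent_0, of t t' x "image_angle c"] t' assms(5) by auto
  then obtain m :: int where m: "x = image_angle c + 2 * pi * of_int m"
    using sin_cos_eq_iff by blast
  then have "0 < 2 * pi * of_int m" "2 * pi * of_int m < 2 * pi * 1"
    using x pi_gt_zero by linarith+
  then have "0 < m" "m < 1"
    by (simp_all add: zero_less_mult_iff)
  then show False by simp
qed

section \<open>Stacking the faces as an accordion\<close>

definition layer :: "nat \<Rightarrow> nat \<Rightarrow> nat" where
  "layer c i = (if c \<le> i then i - c else i + n - c)"

lemma layer_inj: "c < n \<Longrightarrow> i < n \<Longrightarrow> j < n \<Longrightarrow> layer c i = layer c j \<longleftrightarrow> i = j"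
  by (auto simp: layer_def)

lemma layer_less: "c < n \<Longrightarrow> i < n \<Longrightarrow> layer c i < n"
  by (auto simp: layer_def)

text \<open>Face \<open>c\<close> starts at crease \<open>c\<close>, so the cyclic numbering from
  \<open>c\<close> jumps only across that crease.\<close>

lemma layer_Suc_mod:
  assumes "c < n" "i < n" "Suc i mod n \<noteq> c"
  shows "layer c (Suc i mod n) = Suc (layer c i)"
  using assms by (cases "Suc i = n") (auto simp: layer_def)

lemma layer_last:
  assumes "i < n"
  shows "layer (Suc i mod n) (Suc i mod n) = 0" "Suc (layer (Suc i mod n) i) = n"
  using assms by (cases "Suc i = n"; simp add: layer_def)+

text \<open>Every crease but \<open>c\<close> joins consecutive layers, which nothing can separate.
  Crease \<open>c\<close> joins the top layer to the bottom one, but no face passes over its image;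
  only creases with the same image remain to be checked against it.\<close>

lemma layer_order_fold_map:
  assumes r: "0 < r" "r \<le> pi" and c: "c < n"
    and low: "\<And>k. k \<le> n \<Longrightarrow> image_angle c \<le> image_angle k"
  shows "layer_order v n d \<alpha> r fold_map (\<lambda>i j. layer c i < layer c j)"
proof -
  let ?b = "\<lambda>i j. layer c i < layer c j"
  have consecutive: "\<not> between ?b i k (Suc i mod n)" if "i < n" "Suc i mod n \<noteq> c" for i k
    using layer_Suc_mod[OF c that] by (auto simp: between_def)
  have nested: "between ?b i j (Suc i mod n) \<longleftrightarrow> between ?b i (Suc j mod n) (Suc i mod n)"
    if ij: "i < n" "j < n" "i \<noteq> j"
      and eq: "fold_map ` crease v d r (Suc i mod n) = fold_map ` crease v d r (Suc j mod n)" for i j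
  proof (cases "Suc i mod n = c")
    case False
    then show ?thesis using consecutive ij by blast
  next
    case True
    \<comment> \<open>All layers other than top and bottom lie between these two. If crease
      \<open>Suc j mod n\<close> joined the top or the bottom layer, it would be a neighbour of
      crease \<open>c\<close>, and their images would differ.\<close>
    have top: "layer c (Suc i mod n) = 0" "Suc (layer c i) = n"
      using layer_last[OF ij(1)] True by auto
    have "layer c j \<noteq> layer c i" using layer_inj[OF c] ij by blast
    then have jn: "Suc (layer c j) < n" using layer_less[OF c ij(2)] top by linarith
    have "Suc j mod n \<noteq> c"
      using layer_last(2)[OF ij(2)] jn by auto
    then have sj: "layer c (Suc j mod n) = Suc (layer c j)"
      by (rule layer_Suc_mod[OF c ij(2)])
    have "layer c j \<noteq> 0"
    proof
      assume "layer c j = 0"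
      then have "j = Suc i mod n" using top layer_inj[OF c ij(2) suc_mod_less] by simp
      then show False using adjacent_crease_images[OF ij(1) r] eq by blast
    qed
    moreover have "Suc (layer c j) \<noteq> layer c i"
    proof
      assume "Suc (layer c j) = layer c i"
      then have "i = Suc j mod n" using sj layer_inj[OF c ij(1) suc_mod_less] by metis
      then show False using adjacent_crease_images[OF ij(2) r] eq by metis
    qed
    ultimately show ?thesis
      using jn top sj by (auto simp: between_def)
  qed
  show ?thesis
    unfolding layer_order_def Let_def
  proof (intro conjI allI impI)
    fix i j assume "i < n" "j < n"
      "i \<noteq> j \<and> fold_map ` open_face v d \<alpha> r i \<inter> fold_map ` open_face v d \<alpha> r j \<noteq> {}"
    then show "?b i j \<longleftrightarrow> \<not> ?b j i"
      using layer_inj[OF c, of i j] by auto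
  next
    fix i k
    assume "i < n" "k < n" and ik: "k \<noteq> i \<and> k \<noteq> Suc i mod n \<and>
      fold_map ` crease v d r (Suc i mod n) \<inter> fold_map ` open_face v d \<alpha> r k \<noteq> {}"
    then have "Suc i mod n \<noteq> c"
      using lowest_crease_uncovered[OF low _ _ _ r(2)] by blast
    then show "\<not> between ?b i k (Suc i mod n)"
      using consecutive \<open>i < n\<close> by blast
  qed (use nested in auto)
qed

lemma flat_foldable: "flat_foldable v n d l \<alpha>"
proof -
  \<comment> \<open>The minimum keeps the disc within all arcs; the cap 1 serves
    \<open>folded_map_fold_map\<close>.\<close>
  define r where "r = Min (insert 1 (l ` {..<n}))"
  have r: "0 < r" "r \<le> 1" "\<And>i. i < n \<Longrightarrow> r \<le> l i"
    using arc(3) by (auto simp: r_def)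
  then have rpi: "r \<le> pi" using pi_gt3 by simp
  obtain c where "c < n" "\<And>k. k \<le> n \<Longrightarrow> image_angle c \<le> image_angle k"
    using lowest_crease by blast
  then have "layer_order v n d \<alpha> r fold_map (\<lambda>i j. layer c i < layer c j)"
    by (intro layer_order_fold_map r rpi)
  then show ?thesis
    unfolding flat_foldable_def using r rpi folded_map_fold_map by blast
qed

end

theorem theorem2:
  fixes v :: "real^3" and n :: nat and d :: "nat \<Rightarrow> real^3" and l \<alpha> :: "nat \<Rightarrow> real"
  assumes "crease_pattern v n d l \<alpha>"
  shows "flat_foldable v n d l \<alpha> \<longleftrightarrow> even n \<and> (\<Sum>i<n. (-1) ^ i * \<alpha> i) = 0"
proof
  assume "flat_foldable v n d l \<alpha>"
  then show "even n \<and> (\<Sum>i<n. (-1) ^ i * \<alpha> i) = 0"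
    using folded_map_alternating[OF assms] by (auto simp: flat_foldable_def)
next
  assume "even n \<and> (\<Sum>i<n. (-1) ^ i * \<alpha> i) = 0"
  then interpret alternating_pattern v n d l \<alpha>
    using assms by unfold_locales auto
  show "flat_foldable v n d l \<alpha>" by (rule flat_foldable)
qed

end
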